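(* Let $n \ge 1$ be an integer. The ladder $P_n \times P_2$ has a consecutive cyclic prime labeling with the value $1$ assigned to vertex $v_1$ if and only if $2n+1$ is prime.
   Context: The ladder $P_n \times P_2$ is the simple graph with $2n$ vertices $v_1, \ldots, v_n$ (top row, left to right) and $u_1, \ldots, u_n$ (bottom row, left to right), whose edges are $v_i u_i$ for $1 \le i \le n$, and $v_i v_{i+1}$, $u_i u_{i+1}$ for $1 \le i \le n-1$. A prime labeling of a simple graph with $N$ vertices is a bijection from its vertex set to $\{1, 2, \ldots, N\}$ such that the labels of any two adjacent vertices are relatively prime. A consecutive cyclic labeling of $P_n \times P_2$ is a bijective labeling of its vertices by $\{1, \ldots, 2n\}$ in which the labels wrap consecutively (clockwise) around the ladder: arranging the vertices in the cyclic order $v_1, v_2, \ldots, v_n, u_n, u_{n-1}, \ldots, u_1$ (then back to $v_1$), the label $1$ is placed on some vertex and the labels $2, 3, \ldots, 2n$ are placed successively on the following vertices in this cyclic order. (So if $1$ is on $v_i$, then $v_n$ has label $n-i+1$, $u_n$ has label $n-i+2$, $u_1$ has label $2n-i+1$, and, if $i \ge 2$, $v_1$ has label $2n-i+2$ and $v_{i-1}$ has label $2n$.) A consecutive cyclic prime labeling is a consecutive cyclic labeling that is also a prime labeling. *)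

theory Defs
  imports
    "Graph_Theory.Pair_Digraph"
    "HOL-Computational_Algebra.Primes"
begin

text \<open>An undirected edge is represented by its two opposite arcs.\<close>

definition prime_labeling :: "'a pair_pre_digraph \<Rightarrow> ('a \<Rightarrow> nat) \<Rightarrow> bool" where
  "prime_labeling G f \<longleftrightarrow>
     bij_betw f (pverts G) {1..card (pverts G)} \<and>
     (\<forall>(x, y) \<in> parcs G. coprime (f x) (f y))"

text \<open>\<open>V i\<close> is the \<open>i\<close>-th vertex of the top row and \<open>U i\<close> the \<open>i\<close>-th vertex of the bottom row,
  for \<open>1 \<le> i \<le> n\<close>, counted from left to right.\<close>

datatype ladder_vertex = V nat | U nat

definition ladder_edges :: "nat \<Rightarrow> ladder_vertex rel" where
  "ladder_edges n =
     {(V i, U i) | i. 1 \<le> i \<and> i \<le> n}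
     \<union> {(V i, V (i + 1)) | i. 1 \<le> i \<and> i + 1 \<le> n}
     \<union> {(U i, U (i + 1)) | i. 1 \<le> i \<and> i + 1 \<le> n}"

definition ladder :: "nat \<Rightarrow> ladder_vertex pair_pre_digraph" where
  "ladder n =
     \<lparr>pverts = V ` {1..n} \<union> U ` {1..n},
      parcs = ladder_edges n \<union> (ladder_edges n)\<inverse>\<rparr>"

text \<open>The clockwise order \<open>v\<^sub>1, \<dots>, v\<^sub>n, u\<^sub>n, \<dots>, u\<^sub>1\<close>.\<close>

definition ladder_cycle :: "nat \<Rightarrow> ladder_vertex list" where
  "ladder_cycle n = map V [1..<n + 1] @ map U (rev [1..<n + 1])"

text \<open>The rotation by \<open>k\<close> starts the cyclic order at the vertex labeled 1.\<close>

definition consecutive_cyclic_labeling :: "nat \<Rightarrow> (ladder_vertex \<Rightarrow> nat) \<Rightarrow> bool" where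
  "consecutive_cyclic_labeling n f \<longleftrightarrow>
     bij_betw f (pverts (ladder n)) {1..2 * n} \<and>
     (\<exists>k. map f (rotate k (ladder_cycle n)) = [1..<2 * n + 1])"

definition consecutive_cyclic_prime_labeling :: "nat \<Rightarrow> (ladder_vertex \<Rightarrow> nat) \<Rightarrow> bool" where
  "consecutive_cyclic_prime_labeling n f \<longleftrightarrow>
     consecutive_cyclic_labeling n f \<and> prime_labeling (ladder n) f"

lemma card_pverts_ladder: "card (pverts (ladder n)) = 2 * n"
proof -
  have "card (V ` {1..n} \<union> U ` {1..n}) = card (V ` {1..n}) + card (U ` {1..n})"
    by (rule card_Un_disjoint) auto
  also have "\<dots> = 2 * n"
    by (simp add: card_image inj_on_def)
  finally show ?thesis
    by (simp add: ladder_def)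
qed

lemma pair_graph_ladder: "pair_graph (ladder n)"
proof
  have sub: "parcs (ladder n) \<subseteq> pverts (ladder n) \<times> pverts (ladder n)"
    by (auto simp: ladder_def ladder_edges_def)
  then show "fst e \<in> pverts (ladder n)" "snd e \<in> pverts (ladder n)"
    if "e \<in> parcs (ladder n)" for e
    using that by auto
  show fin: "finite (pverts (ladder n))"
    by (simp add: ladder_def)
  show "finite (parcs (ladder n))"
    using sub fin by (meson finite_SigmaI finite_subset)
  show "symmetric (with_proj (ladder n))"
    by (auto simp: symmetric_def sym_def ladder_def)
  show "fst e \<noteq> snd e" if "e \<in> parcs (ladder n)" for e
    using that by (auto simp: ladder_def ladder_edges_def)
qed

lemma set_ladder_cycle: "set (ladder_cycle n) = pverts (ladder n)"
  by (auto simp: ladder_cycle_def ladder_def)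

lemma distinct_ladder_cycle: "distinct (ladder_cycle n)"
  by (auto simp: ladder_cycle_def distinct_map inj_on_def)

end

theory Submission
  imports Defs
begin

text \<open>
  Fixing the label 1 at \<open>V 1\<close> fixes the whole labeling: clockwise consecutiveness forces
  \<open>V i\<close> to receive \<open>i\<close> and \<open>U i\<close> to receive \<open>2n + 1 - i\<close>. Horizontal edges
  then carry consecutive integers, so only the rungs matter, and a rung joins two labels with
  sum \<open>2n + 1\<close>. Since \<open>gcd i (2n + 1 - i) = gcd i (2n + 1)\<close>, the labeling is prime iff
  \<open>2n + 1\<close> is coprime to each of \<open>1, \<dots>, n\<close>. A composite odd number \<open>2n + 1\<close>
  has a nontrivial divisor whose cofactor is at least 2, and this divisor is at most \<open>n\<close>;
  hence the condition holds exactly for prime \<open>2n + 1\<close>.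
  The two halves of the argument are \<open>labeling_from_V1_iff\<close> and
  \<open>prime_iff_coprime_lower_half\<close>.
\<close>

text \<open>On a distinct list, a function that lists distinct values along a rotation reveals the
  amount of the rotation by where it takes its first value.\<close>

lemma rotate_eq_self_if_hd_value:
  assumes "distinct ys" and "xs \<noteq> []" and "map f (rotate k xs) = ys" and "f (hd xs) = hd ys"
  shows "rotate k xs = xs"
proof -
  have inj: "inj_on f (set xs)" and dist: "distinct xs"
    using assms(1,3) by (metis distinct_map set_rotate, metis distinct_map distinct_rotate)
  have "hd ys = f (hd (rotate k xs))"
    using assms(2,3) by (metis hd_map rotate_is_Nil_conv)
  then have "f (xs ! (k mod length xs)) = f (xs ! 0)"
    using assms(2,4) by (simp only: hd_rotate_conv_nth[OF assms(2)] hd_conv_nth[OF assms(2)])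
  then have "xs ! (k mod length xs) = xs ! 0"
    using inj assms(2) by (simp add: inj_on_eq_iff)
  then have "k mod length xs = 0"
    using dist assms(2) by (simp add: nth_eq_iff_index_eq)
  then show ?thesis
    by (metis rotate_conv_mod rotate0 id_apply)
qed

text \<open>Read along the cycle, the labels \<open>2n + 1 - i\<close> of the reversed bottom row continue those
  of the top row.\<close>

lemma map_ladder_cycle_eq_upt_iff:
  "map f (ladder_cycle n) = [1..<2 * n + 1] \<longleftrightarrow>
     (\<forall>i\<in>{1..n}. f (V i) = i \<and> f (U i) = 2 * n + 1 - i)"
proof -
  have top_bottom: "[1..<2 * n + 1] = [1..<n + 1] @ [n + 1..<2 * n + 1]"
    using upt_add_eq_append[of 1 "n + 1" n] by (simp add: mult_2)
  have bottom: "[n + 1..<2 * n + 1] = map (\<lambda>i. 2 * n + 1 - i) (rev [1..<n + 1])"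
    by (rule nth_equalityI) (auto simp: rev_nth simp del: upt_Suc)
  have top: "map (\<lambda>i. f (V i)) [1..<n + 1] = [1..<n + 1] \<longleftrightarrow> (\<forall>i\<in>{1..n}. f (V i) = i)"
    using map_eq_conv[of "\<lambda>i. f (V i)" "[1..<n + 1]" "\<lambda>i. i"]
    by (auto simp del: upt_Suc)
  show ?thesis
    unfolding top_bottom bottom ladder_cycle_def
    using top by (auto simp: comp_def simp del: upt_Suc)
qed

text \<open>The label 1 at the head of the cycle excludes every rotation but the trivial one.
  Conversely, an assignment whose values along the cycle are \<open>1, \<dots>, 2n\<close> is a bijection,
  because these values are distinct and exhaust the labels.\<close>

lemma labeling_from_V1_iff:
  assumes "n \<ge> 1"
  shows "consecutive_cyclic_labeling n f \<and> f (V 1) = 1 \<longleftrightarrow>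
     (\<forall>i\<in>{1..n}. f (V i) = i \<and> f (U i) = 2 * n + 1 - i)"
proof -
  have cycle: "ladder_cycle n \<noteq> []" "hd (ladder_cycle n) = V 1"
    using assms by (simp_all add: ladder_cycle_def upt_conv_Cons del: upt_Suc)
  have labels: "hd [1..<2 * n + 1] = 1"
    using assms by (simp add: upt_conv_Cons)
  have "consecutive_cyclic_labeling n f \<and> f (V 1) = 1 \<longleftrightarrow>
      map f (ladder_cycle n) = [1..<2 * n + 1]"
  proof
    assume "consecutive_cyclic_labeling n f \<and> f (V 1) = 1"
    then obtain k where k: "map f (rotate k (ladder_cycle n)) = [1..<2 * n + 1]"
      and "f (V 1) = 1"
      by (auto simp: consecutive_cyclic_labeling_def)
    then have "rotate k (ladder_cycle n) = ladder_cycle n"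
      using cycle labels by (intro rotate_eq_self_if_hd_value[OF _ _ k]) simp_all
    with k show "map f (ladder_cycle n) = [1..<2 * n + 1]"
      by simp
  next
    assume map: "map f (ladder_cycle n) = [1..<2 * n + 1]"
    have "inj_on f (pverts (ladder n))"
      using map by (metis distinct_map distinct_upt set_ladder_cycle)
    moreover have "f ` pverts (ladder n) = {1..2 * n}"
      using arg_cong[OF map, of set] by (auto simp: set_ladder_cycle simp del: upt_Suc)
    ultimately have "bij_betw f (pverts (ladder n)) {1..2 * n}"
      by (simp add: bij_betw_def)
    moreover have "\<exists>k. map f (rotate k (ladder_cycle n)) = [1..<2 * n + 1]"
      by (rule exI[of _ 0]) (use map in simp)
    moreover have "f (V 1) = 1"
      using arg_cong[OF map, of hd] cycle labels by (simp add: hd_map)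
    ultimately show "consecutive_cyclic_labeling n f \<and> f (V 1) = 1"
      by (simp add: consecutive_cyclic_labeling_def)
  qed
  then show ?thesis
    by (simp only: map_ladder_cycle_eq_upt_iff)
qed

text \<open>Both rows carry runs of consecutive integers, so coprimality along them is automatic and
  only the rungs remain.\<close>

lemma coprime_ladder_arcs_iff:
  assumes f: "\<forall>i\<in>{1..n}. f (V i) = i \<and> f (U i) = 2 * n + 1 - i"
  shows "(\<forall>(x, y) \<in> parcs (ladder n). coprime (f x) (f y)) \<longleftrightarrow>
     (\<forall>i\<in>{1..n}. coprime i (2 * n + 1))"
proof -
  have rung: "coprime i (2 * n + 1 - i) \<longleftrightarrow> coprime i (2 * n + 1)" if "i \<in> {1..n}" for i
  proof -
    have "gcd i (2 * n + 1 - i) = gcd i (2 * n + 1)"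
      using gcd_diff1_nat[of i "2 * n + 1"] that by (simp add: gcd.commute)
    then show ?thesis
      by (simp only: coprime_iff_gcd_eq_1)
  qed
  have consecutive: "coprime (f (V i)) (f (V (i + 1)))" "coprime (f (U i)) (f (U (i + 1)))"
    if "1 \<le> i" "i + 1 \<le> n" for i
  proof -
    show "coprime (f (V i)) (f (V (i + 1)))"
      using f that by simp
    have "2 * n + 1 - i = Suc (2 * n - i)" "2 * n + 1 - (i + 1) = 2 * n - i"
      using that by auto
    then show "coprime (f (U i)) (f (U (i + 1)))"
      using f that coprime_Suc_left_nat[of "2 * n - i"] by simp
  qed
  have "(\<forall>(x, y) \<in> parcs (ladder n). coprime (f x) (f y)) \<longleftrightarrow>
      (\<forall>(x, y) \<in> ladder_edges n. coprime (f x) (f y))"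
    by (auto simp: ladder_def coprime_commute)
  also have "\<dots> \<longleftrightarrow> (\<forall>i\<in>{1..n}. coprime (f (V i)) (f (U i)))"
    using consecutive by (auto simp: ladder_edges_def Ball_def)
  also have "\<dots> \<longleftrightarrow> (\<forall>i\<in>{1..n}. coprime i (2 * n + 1))"
    using f rung by auto
  finally show ?thesis .
qed

text \<open>A proper divisor \<open>d\<close> satisfies \<open>2d \<le> 2n + 1\<close>, hence \<open>d \<le> n\<close>.\<close>

lemma prime_iff_coprime_lower_half:
  fixes n :: nat
  assumes "n \<ge> 1"
  shows "prime (2 * n + 1) \<longleftrightarrow> (\<forall>i\<in>{1..n}. coprime i (2 * n + 1))"
proof
  assume p: "prime (2 * n + 1)"
  show "\<forall>i\<in>{1..n}. coprime i (2 * n + 1)"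
  proof
    fix i assume "i \<in> {1..n}"
    then have "\<not> 2 * n + 1 dvd i"
      using nat_dvd_not_less[of i "2 * n + 1"] by auto
    then show "coprime i (2 * n + 1)"
      using p prime_imp_coprime coprime_commute by blast
  qed
next
  assume coprime: "\<forall>i\<in>{1..n}. coprime i (2 * n + 1)"
  show "prime (2 * n + 1)"
  proof (rule prime_nat_iff[THEN iffD2], intro conjI allI impI)
    show "1 < 2 * n + 1"
      using assms by simp
    fix d assume d: "d dvd 2 * n + 1"
    show "d = 1 \<or> d = 2 * n + 1"
    proof (cases "d \<le> n")
      case True
      have "d \<noteq> 0"
        using d by (intro notI) simp
      with True coprime have "coprime d (2 * n + 1)"
        by simp
      with d have "d = 1"
        using coprime_common_divisor[of d "2 * n + 1" d] by simp
      then show ?thesis ..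
    next
      case False
      obtain m where m: "2 * n + 1 = d * m"
        using d by blast
      have "m < 2"
      proof (rule ccontr)
        assume "\<not> m < 2"
        then have "d * 2 \<le> d * m"
          by (intro mult_le_mono2) simp
        with m False show False
          by linarith
      qed
      moreover have "m \<noteq> 0"
        using m by (intro notI) simp
      ultimately have "m = 1"
        by linarith
      with m show ?thesis
        by simp
    qed
  qed
qed

theorem theorem3:
  fixes n :: nat
  assumes "n \<ge> 1"
  shows "(\<exists>f. consecutive_cyclic_prime_labeling n f \<and> f (V 1) = 1) \<longleftrightarrow> prime (2 * n + 1)"
proof -
  let ?labels = "\<lambda>f. \<forall>i\<in>{1..n}. f (V i) = i \<and> f (U i) = 2 * n + 1 - i"
  have "consecutive_cyclic_prime_labeling n f \<and> f (V 1) = 1 \<longleftrightarrow>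
      ?labels f \<and> prime (2 * n + 1)" for f
  proof -
    have "consecutive_cyclic_prime_labeling n f \<and> f (V 1) = 1 \<longleftrightarrow>
        (consecutive_cyclic_labeling n f \<and> f (V 1) = 1) \<and>
        (\<forall>(x, y) \<in> parcs (ladder n). coprime (f x) (f y))"
      by (auto simp: consecutive_cyclic_prime_labeling_def consecutive_cyclic_labeling_def
          prime_labeling_def card_pverts_ladder)
    also have "\<dots> \<longleftrightarrow> ?labels f \<and> (\<forall>(x, y) \<in> parcs (ladder n). coprime (f x) (f y))"
      by (simp only: labeling_from_V1_iff[OF assms])
    also have "\<dots> \<longleftrightarrow> ?labels f \<and> prime (2 * n + 1)"
      by (rule conj_cong[OF refl],
          rule trans[OF coprime_ladder_arcs_iff prime_iff_coprime_lower_half[OF assms, symmetric]])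
    finally show ?thesis .
  qed
  moreover have "?labels (case_ladder_vertex (\<lambda>i. i) (\<lambda>i. 2 * n + 1 - i))"
    by simp
  ultimately show ?thesis
    by blast
qed

end
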